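(* Let $i,k$ be nonnegative integers. For every integer $N\ge 1$, \[ F_N(i,0,k;x) - F_{N-1}(i,0,k;xq) - xq^{i+1} F_{N-2}(i,0,k;xq^2) + x^{2k+1}q^{\binom{2k+2}{2}+i} F_{N-(2k+1)}(i,0,k;xq^{2k+1})=0. \]
   Context: Gaussian binomial: ${A\brack B}_q=0$ if $B>A$ or $B<0$, otherwise $\frac{(q;q)_A}{(q;q)_B(q;q)_{A-B}}$, with $(a;q)_n=\prod_{t=0}^{n-1}(1-aq^t)$. For nonnegative integers $i,k$ and integer $N$: $F_N(i,0,k;x)=0$ if $N<0$, and for $N\ge 0$ \[ F_N(i,0,k;x)=\sum_{m,n\geq 0} (-1)^n q^{\binom{(2k+1)n+1}{2} + m^2 + (2k+1)mn + i(m+n)} x^{m+(2k+1)n} {N-(2k+1)n-m\brack m}_q {N-2kn -m \brack n}_{q^{2k+1}}. \] $F_N(i,0,k;xq^r)$ denotes this polynomial with $x$ replaced by $xq^r$. *)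

theory Defs
  imports
    "HOL-Computational_Algebra.Polynomial"
    "HOL-Library.Groups_Big_Fun"
begin

definition qpoch :: "'a::comm_ring_1 \<Rightarrow> 'a \<Rightarrow> nat \<Rightarrow> 'a" where
  "qpoch a q n = (\<Prod>t<n. 1 - a * q ^ t)"

text \<open>
  The quotient is the usual Gaussian binomial as soon as \<open>q\<close> satisfies \<open>q ^ j \<noteq> 1\<close> for
  all \<open>j > 0\<close>, so that no denominator vanishes. The value is \<open>0\<close> whenever \<open>A\<close> is negative,
  since then either \<open>B < 0\<close> or \<open>B > A\<close>.
\<close>
definition gauss_binom :: "'a::field \<Rightarrow> int \<Rightarrow> int \<Rightarrow> 'a" where
  "gauss_binom q A B =
     (if B > A \<or> B < 0 then 0
      else qpoch q q (nat A) / (qpoch q q (nat B) * qpoch q q (nat (A - B))))"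

definition F_coeff :: "'a::field \<Rightarrow> int \<Rightarrow> nat \<Rightarrow> nat \<Rightarrow> nat \<Rightarrow> nat \<Rightarrow> 'a" where
  "F_coeff q N i k m n =
     (- 1) ^ n
     * q ^ ((((2 * k + 1) * n + 1) choose 2) + m ^ 2 + (2 * k + 1) * m * n + i * (m + n))
     * gauss_binom q (N - (2 * int k + 1) * int n - int m) (int m)
     * gauss_binom (q ^ (2 * k + 1)) (N - 2 * int k * int n - int m) (int n)"

text \<open>
  \<open>F_poly q N i k\<close> is \<open>F\<^sub>N(i, 0, k; x)\<close> as a polynomial in \<open>x\<close>. The constant \<open>Sum_any\<close> sums
  over all pairs of naturals \<open>(m, n)\<close>; it would be \<open>0\<close> for infinite support, but the support
  is finite by \<open>finite_F_support\<close> below.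
\<close>
definition F_poly :: "'a::field \<Rightarrow> int \<Rightarrow> nat \<Rightarrow> nat \<Rightarrow> 'a poly" where
  "F_poly q N i k =
     (if N < 0 then 0
      else Sum_any (\<lambda>(m, n). monom (F_coeff q N i k m n) (m + (2 * k + 1) * n)))"

text \<open>The substitution \<open>x \<mapsto> c x\<close>.\<close>
definition dilate :: "'a::comm_ring_1 \<Rightarrow> 'a poly \<Rightarrow> 'a poly" where
  "dilate c p = pcompose p [:0, c:]"

lemma F_coeff_eq_0:
  assumes "int m > N \<or> int n > N"
  shows "F_coeff q N i k m n = 0"
proof -
  have "0 \<le> 2 * int k * int n" "(2 * int k + 1) * int n = 2 * int k * int n + int n"
    by (simp_all add: algebra_simps)
  with assms have "int m > N - (2 * int k + 1) * int n - int m
      \<or> int n > N - 2 * int k * int n - int m"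
    by linarith
  thus ?thesis unfolding F_coeff_def gauss_binom_def by auto
qed

lemma F_support_subset:
  "{z. (case z of (m, n) \<Rightarrow> monom (F_coeff q N i k m n) (m + (2 * k + 1) * n)) \<noteq> 0}
     \<subseteq> {..nat N} \<times> {..nat N}"
proof (clarsimp simp del: mult_Suc)
  fix m n
  assume "F_coeff q N i k m n \<noteq> 0"
  hence "\<not> (int m > N \<or> int n > N)" using F_coeff_eq_0 by blast
  thus "m \<le> nat N \<and> n \<le> nat N" by linarith
qed

lemma finite_F_support:
  "finite {z. (case z of (m, n) \<Rightarrow> monom (F_coeff q N i k m n) (m + (2 * k + 1) * n)) \<noteq> 0}"
  by (rule finite_subset[OF F_support_subset]) simp

lemma F_poly_eq_finite_sum:
  assumes "N \<ge> 0"
  shows "F_poly q N i k =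
    (\<Sum>m\<le>nat N. \<Sum>n\<le>nat N. monom (F_coeff q N i k m n) (m + (2 * k + 1) * n))"
proof -
  let ?g = "\<lambda>(m, n). monom (F_coeff q N i k m n) (m + (2 * k + 1) * n)"
  have "Sum_any ?g = sum ?g ({..nat N} \<times> {..nat N})"
    by (rule Sum_any.expand_superset[OF _ F_support_subset]) simp
  thus ?thesis using assms by (simp add: F_poly_def sum.cartesian_product)
qed

end

theory Submission
  imports Defs
begin

text \<open>
  The recurrence holds separately for each pair \<open>(m, n)\<close>. Put \<open>K = 2k + 1\<close>, \<open>Q = q\<^sup>K\<close> and
  \<open>a = N - Kn - m\<close>. After the common power of \<open>q\<close> and the sign are removed, the coefficient of
  the summand \<open>(m, n)\<close> becomes
  \<open>[a; m] [a+n; n]\<^sub>Q - Q\<^sup>n (q\<^sup>m [a-1; m] + [a-1; m-1]) [a+n-1; n]\<^sub>Q - [a; m] [a+n-1; n-1]\<^sub>Q\<close>,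
  which vanishes by Pascal's rule in base \<open>q\<close> followed by Pascal's rule in base \<open>Q\<close>.
\<close>

lemma qpoch_Suc: "qpoch a q (Suc n) = qpoch a q n * (1 - a * q ^ n)"
  by (simp add: qpoch_def)

lemma qpoch_nonzero:
  fixes q :: "'a::field"
  assumes "\<And>j::nat. j > 0 \<Longrightarrow> q ^ j \<noteq> 1"
  shows "qpoch q q n \<noteq> 0"
proof -
  have "1 - q * q ^ t \<noteq> 0" for t
    using assms[of "Suc t"] by simp
  thus ?thesis by (simp add: qpoch_def)
qed

lemma gauss_binom_eq_0: "B > A \<or> B < 0 \<Longrightarrow> gauss_binom q A B = 0"
  by (auto simp: gauss_binom_def)

lemma gauss_binom_0_right:
  fixes q :: "'a::field"
  assumes "\<And>j::nat. j > 0 \<Longrightarrow> q ^ j \<noteq> 1" "A \<ge> 0"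
  shows "gauss_binom q A 0 = 1"
  using qpoch_nonzero[OF assms(1)] assms(2) by (simp add: gauss_binom_def qpoch_def)

lemma gauss_binom_self:
  fixes q :: "'a::field"
  assumes "\<And>j::nat. j > 0 \<Longrightarrow> q ^ j \<noteq> 1" "A \<ge> 0"
  shows "gauss_binom q A A = 1"
  using qpoch_nonzero[OF assms(1)] assms(2) by (simp add: gauss_binom_def qpoch_def)

lemma gauss_binom_add:
  "gauss_binom q (int (b + c)) (int b) = qpoch q q (b + c) / (qpoch q q b * qpoch q q c)"
  by (simp add: gauss_binom_def nat_add_distrib)

text \<open>The value \<open>A = 0\<close> must be excluded: for \<open>A = B = 0\<close> the left
  side is 1, while both binomials on the right have top -1 and vanish. For negative \<open>A\<close>
  all three are 0.\<close>

lemma gauss_binom_pascal: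
  fixes q :: "'a::field"
  assumes q: "\<And>j::nat. j > 0 \<Longrightarrow> q ^ j \<noteq> 1" and A: "A \<noteq> 0"
  shows "gauss_binom q A (int B) =
    gauss_binom q (A - 1) (int B - 1) + q ^ B * gauss_binom q (A - 1) (int B)"
proof -
  note nz = qpoch_nonzero[OF q]
  consider "int B > A" | "int B = A" | "B = 0" "A > 0" | "B > 0" "int B < A"
    using A by linarith
  thus ?thesis
  proof cases
    case 1
    thus ?thesis by (simp add: gauss_binom_eq_0)
  next
    case 2
    with A have "A > 0" by simp
    with 2 show ?thesis by (simp add: gauss_binom_eq_0 gauss_binom_self[OF q])
  next
    case 3
    thus ?thesis by (simp add: gauss_binom_eq_0 gauss_binom_0_right[OF q])
  next
    case 4
    define b c where "b = B - 1" and "c = nat (A - int B) - 1"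
    have B: "B = Suc b" and A': "A = int (Suc b + Suc c)"
      using 4 by (auto simp: b_def c_def)
    have 0: "gauss_binom q A (int B) =
        qpoch q q (Suc (Suc (b + c))) / (qpoch q q (Suc b) * qpoch q q (Suc c))"
      unfolding A' B gauss_binom_add by simp
    have 1: "gauss_binom q (A - 1) (int B - 1) =
        qpoch q q (Suc (b + c)) / (qpoch q q b * qpoch q q (Suc c))"
      using gauss_binom_add[of q b "Suc c"] unfolding A' B by (simp add: algebra_simps)
    have 2: "gauss_binom q (A - 1) (int B) =
        qpoch q q (Suc (b + c)) / (qpoch q q (Suc b) * qpoch q q c)"
      using gauss_binom_add[of q "Suc b" c] unfolding A' B by (simp add: algebra_simps)
    have "1 - q * q ^ b \<noteq> 0" "1 - q * q ^ c \<noteq> 0"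
      using q[of "Suc b"] q[of "Suc c"] by simp_all
    \<comment> \<open>Clearing denominators leaves 1 - q^(b+c+2) = (1 - q^(b+1)) + q^(b+1) (1 -
      q^(c+1)).\<close>
    thus ?thesis
      unfolding 0 1 2 unfolding B qpoch_Suc
      using nz[of b] nz[of c] nz[of "b + c"]
      by (simp add: divide_simps) (simp add: algebra_simps power_add)
  qed
qed

text \<open>A pair in a disjoint union lies in one part or has one element in each. This tracks the
  exponent of \<open>q\<close> when \<open>n\<close> grows by 1.\<close>

lemma choose_two_add:
  "(a + b) choose 2 = (a choose 2) + (b choose 2) + a * b"
  by (induction b) (auto simp: numeral_2_eq_2 algebra_simps)

text \<open>Different pairs (m, n) may share the degree m + (2k+1)n, so this is finer than comparing
  coefficients of x. The powers with exponents of that shape come from the dilations. Multiplication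
  by x raises m by 1 and multiplication by x^(2k+1) raises n by 1; nothing is shifted to m = 0 or n
  = 0, hence the zero branches.\<close>

lemma F_coeff_recurrence:
  fixes q :: "'a::field"
  assumes q: "\<And>j::nat. j > 0 \<Longrightarrow> q ^ j \<noteq> 1" and N: "N \<ge> 1"
  shows "F_coeff q N i k m n =
    q ^ (m + (2 * k + 1) * n) * F_coeff q (N - 1) i k m n
    + (case m of 0 \<Rightarrow> 0 | Suc m' \<Rightarrow>
        q ^ (i + 1) * (q ^ 2) ^ (m' + (2 * k + 1) * n) * F_coeff q (N - 2) i k m' n)
    - (case n of 0 \<Rightarrow> 0 | Suc n' \<Rightarrow>
        q ^ (((2 * k + 2) choose 2) + i) * (q ^ (2 * k + 1)) ^ (m + (2 * k + 1) * n')
          * F_coeff q (N - (2 * int k + 1)) i k m n')"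
proof -
  define K where "K = 2 * k + 1"
  \<comment> \<open>Since K = 2k + 1, the top N - 2kn - m of the second binomial is a + n.\<close>
  define a where "a = N - int K * int n - int m"
  define E where "E = ((K * n + 1) choose 2) + m ^ 2 + K * m * n + i * (m + n)"
  define g where "g = gauss_binom q"
  define h where "h = gauss_binom (q ^ K)"
  define s :: 'a where "s = (- 1) ^ n * q ^ E"
  have K: "int K = 2 * int k + 1" "2 * k + 2 = K + 1"
    by (simp_all add: K_def)
  \<comment> \<open>Pascal's rule in base \<open>q ^ K\<close> needs the same hypothesis for that
    base; it is inherited because K > 0.\<close>
  have Q: "(q ^ K) ^ j \<noteq> 1" if "j > 0" for j
    unfolding power_mult[symmetric] using that by (intro q) (simp add: K_def)
  have F0: "F_coeff q N i k m n = s * g a (int m) * h (a + int n) (int n)"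
    unfolding F_coeff_def a_def g_def h_def s_def E_def K_def
    by (simp add: algebra_simps)
  have F1: "F_coeff q (N - 1) i k m n = s * g (a - 1) (int m) * h (a + int n - 1) (int n)"
    unfolding F_coeff_def a_def g_def h_def s_def E_def K_def
    by (simp add: algebra_simps)
  have F2: "(case m of 0 \<Rightarrow> 0 | Suc m' \<Rightarrow>
        q ^ (i + 1) * (q ^ 2) ^ (m' + (2 * k + 1) * n) * F_coeff q (N - 2) i k m' n)
      = s * q ^ (K * n) * g (a - 1) (int m - 1) * h (a + int n - 1) (int n)"
  proof (cases m)
    case 0
    thus ?thesis by (simp add: g_def gauss_binom_eq_0)
  next
    case (Suc m')
    define E' where "E' = ((K * n + 1) choose 2) + m' ^ 2 + K * m' * n + i * (m' + n)"
    \<comment> \<open>Raising m' by 1 adds 2m' + 1 + Kn + i to the exponent, but the prefactor and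
      the dilation supply 2m' + 1 + 2Kn + i; the surplus Kn is the factor Q^n.\<close>
    have "i + 1 + 2 * (m' + K * n) + E' = E + K * n"
      unfolding E_def E'_def Suc by (simp add: algebra_simps power2_eq_square)
    hence "q ^ (i + 1) * (q ^ 2) ^ (m' + K * n) * q ^ E' = q ^ E * q ^ (K * n)"
      by (metis power_add power_mult)
    moreover have "F_coeff q (N - 2) i k m' n =
        (- 1) ^ n * q ^ E' * g (a - 1) (int m - 1) * h (a + int n - 1) (int n)"
      unfolding F_coeff_def a_def g_def h_def E'_def K_def Suc
      by (simp add: algebra_simps)
    ultimately show ?thesis
      unfolding Suc s_def K_def[symmetric] by (simp add: mult_ac)
  qed
  have F3: "(case n of 0 \<Rightarrow> 0 | Suc n' \<Rightarrow>
        q ^ (((2 * k + 2) choose 2) + i) * (q ^ (2 * k + 1)) ^ (m + (2 * k + 1) * n')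
          * F_coeff q (N - (2 * int k + 1)) i k m n')
      = - s * g a (int m) * h (a + int n - 1) (int n - 1)"
  proof (cases n)
    case 0
    thus ?thesis by (simp add: h_def gauss_binom_eq_0)
  next
    case (Suc n')
    define E' where "E' = ((K * n' + 1) choose 2) + m ^ 2 + K * m * n' + i * (m + n')"
    \<comment> \<open>Here Kn + 1 = (Kn' + 1) + K, and (K choose 2) + K = (K + 1 choose 2). This
      time no surplus power remains, only a sign.\<close>
    have "((K * n + 1) choose 2) = ((K * n' + 1) choose 2) + ((K + 1) choose 2) + K * (K * n')"
      using choose_two_add[of "K * n' + 1" K] choose_two_add[of K 1]
      by (simp add: Suc algebra_simps)
    hence "((K + 1) choose 2) + i + K * (m + K * n') + E' = E"
      unfolding E_def E'_def Suc by (simp add: algebra_simps)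
    hence "q ^ (((K + 1) choose 2) + i) * (q ^ K) ^ (m + K * n') * q ^ E' = q ^ E"
      by (metis power_add power_mult)
    moreover have "F_coeff q (N - (2 * int k + 1)) i k m n' =
        (- 1) ^ n' * q ^ E' * g a (int m) * h (a + int n - 1) (int n - 1)"
      unfolding F_coeff_def a_def g_def h_def E'_def K_def Suc
      by (simp add: algebra_simps)
    ultimately show ?thesis
      unfolding Suc s_def K(2) K_def[symmetric] by (simp add: mult_ac)
  qed
  have pascal: "g a (int m) * h (a + int n) (int n) =
      q ^ (K * n) * (g (a - 1) (int m - 1) + q ^ m * g (a - 1) (int m)) * h (a + int n - 1) (int n)
      + g a (int m) * h (a + int n - 1) (int n - 1)"
  \<comment> \<open>For a > 0 both tops, a and a + n, are nonzero, so both Pascal rules apply.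
    Otherwise the middle term dies because a + n - 1 < n, and \<open>g a (int m)\<close> survives
    only at a = m = 0.\<close>
  proof (cases "a > 0")
    case True
    hence "g a (int m) = g (a - 1) (int m - 1) + q ^ m * g (a - 1) (int m)"
      "h (a + int n) (int n) =
        h (a + int n - 1) (int n - 1) + q ^ (K * n) * h (a + int n - 1) (int n)"
      unfolding g_def h_def power_mult by (auto intro!: gauss_binom_pascal q Q)
    thus ?thesis by (simp add: algebra_simps)
  next
    case False
    hence "h (a + int n - 1) (int n) = 0"
      by (simp add: h_def gauss_binom_eq_0)
    moreover have "g a (int m) = 0" if "a \<noteq> 0 \<or> m \<noteq> 0"
      using that False by (auto simp: g_def gauss_binom_eq_0)
    moreover have "h (a + int n) (int n) = h (a + int n - 1) (int n - 1)" if "a = 0" "m = 0"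
    proof -
      \<comment> \<open>This is where N >= 1 enters: a = m = n = 0 would force N = 0. With n > 0
        both binomials are of the form [A; A] with A >= 0, hence 1.\<close>
      have "n > 0" using that N by (cases n) (auto simp: a_def)
      thus ?thesis using that Q by (simp add: h_def gauss_binom_self)
    qed
    ultimately show ?thesis by force
  qed
  show ?thesis
    unfolding F0 F2 F3 F1 unfolding K_def[symmetric] power_add
    using arg_cong[OF pascal, of "(*) s"] by (simp add: algebra_simps)
qed

text \<open>Padding with zero terms to any large enough rectangle, also for negative N, lets all
  four polynomials be summed over one index set.\<close>

lemma F_poly_eq_sum:
  assumes "int A > N" "int B > N"
  shows "F_poly q N i k =
    (\<Sum>m<A. \<Sum>n<B. monom (F_coeff q N i k m n) (m + (2 * k + 1) * n))"
proof (cases "N < 0")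
  case True
  thus ?thesis by (simp add: F_poly_def F_coeff_eq_0)
next
  case False
  let ?g = "\<lambda>(m, n). monom (F_coeff q N i k m n) (m + (2 * k + 1) * n)"
  have "{..nat N} \<times> {..nat N} \<subseteq> {..<A} \<times> {..<B}"
    using assms False by auto
  hence "Sum_any ?g = sum ?g ({..<A} \<times> {..<B})"
    by (intro Sum_any.expand_superset order_trans[OF F_support_subset]) simp_all
  thus ?thesis using False by (simp add: F_poly_def sum.cartesian_product)
qed

lemma dilate_monom: "dilate c (monom b d) = monom (c ^ d * b) d"
  by (induction d) (simp_all add: dilate_def monom_0 monom_Suc pcompose_pCons smult_monom mult_ac)

lemma dilate_sum: "dilate c (sum f A) = (\<Sum>x\<in>A. dilate c (f x))"
  by (simp add: dilate_def pcompose_sum)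

theorem theorem2p4:
  fixes q :: "'a::field" and i k :: nat and N :: int
  assumes "\<And>j::nat. j > 0 \<Longrightarrow> q ^ j \<noteq> 1"
    and "N \<ge> 1"
  shows "F_poly q N i k
       - dilate q (F_poly q (N - 1) i k)
       - monom (q ^ (i + 1)) 1 * dilate (q ^ 2) (F_poly q (N - 2) i k)
       + monom (q ^ (((2 * k + 2) choose 2) + i)) (2 * k + 1)
           * dilate (q ^ (2 * k + 1)) (F_poly q (N - (2 * int k + 1)) i k) = 0"
proof -
  define K where "K = 2 * k + 1"
  define M where "M = nat N"
  define d where "d m n = m + K * n" for m n
  define u where "u m n = (case m of 0 \<Rightarrow> 0 | Suc m' \<Rightarrow>
    q ^ (i + 1) * (q ^ 2) ^ d m' n * F_coeff q (N - 2) i k m' n)" for m n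
  define v where "v m n = (case n of 0 \<Rightarrow> 0 | Suc n' \<Rightarrow>
    q ^ (((2 * k + 2) choose 2) + i) * (q ^ K) ^ d m n'
      * F_coeff q (N - (2 * int k + 1)) i k m n')" for m n
  have M: "int M = N" using assms(2) by (simp add: M_def)
  have P0: "F_poly q N i k = (\<Sum>m<Suc M. \<Sum>n<Suc M. monom (F_coeff q N i k m n) (d m n))"
    unfolding d_def K_def by (rule F_poly_eq_sum) (simp_all add: M)
  have P1: "dilate q (F_poly q (N - 1) i k) =
      (\<Sum>m<Suc M. \<Sum>n<Suc M. monom (q ^ d m n * F_coeff q (N - 1) i k m n) (d m n))"
  proof -
    have "F_poly q (N - 1) i k =
        (\<Sum>m<Suc M. \<Sum>n<Suc M. monom (F_coeff q (N - 1) i k m n) (d m n))"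
      unfolding d_def K_def by (rule F_poly_eq_sum) (simp_all add: M)
    thus ?thesis by (simp only: dilate_sum dilate_monom)
  qed
  have P2: "monom (q ^ (i + 1)) 1 * dilate (q ^ 2) (F_poly q (N - 2) i k) =
      (\<Sum>m<Suc M. \<Sum>n<Suc M. monom (u m n) (d m n))"
  proof -
    \<comment> \<open>As N - 2 < M, the range of m can stop one short; the shift by x then fills
      1..M, and the row m = 0 is restored with \<open>u 0 n = 0\<close>.\<close>
    have "F_poly q (N - 2) i k =
        (\<Sum>m<M. \<Sum>n<Suc M. monom (F_coeff q (N - 2) i k m n) (d m n))"
      unfolding d_def K_def by (rule F_poly_eq_sum) (simp_all add: M)
    hence "monom (q ^ (i + 1)) 1 * dilate (q ^ 2) (F_poly q (N - 2) i k) =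
        (\<Sum>m<M. \<Sum>n<Suc M. monom (u (Suc m) n) (d (Suc m) n))"
      by (simp only: dilate_sum dilate_monom sum_distrib_left mult_monom)
        (simp add: u_def d_def mult.assoc del: sum.lessThan_Suc)
    thus ?thesis by (simp add: sum.lessThan_Suc_shift[of _ M] u_def del: sum.lessThan_Suc)
  qed
  have P3: "monom (q ^ (((2 * k + 2) choose 2) + i)) (2 * k + 1)
        * dilate (q ^ (2 * k + 1)) (F_poly q (N - (2 * int k + 1)) i k) =
      (\<Sum>m<Suc M. \<Sum>n<Suc M. monom (v m n) (d m n))"
  proof -
    \<comment> \<open>The same device in the n direction: N - K < M because K >= 1, and the restored
      column has \<open>v m 0 = 0\<close>.\<close>
    have "F_poly q (N - (2 * int k + 1)) i k =
        (\<Sum>m<Suc M. \<Sum>n<M. monom (F_coeff q (N - (2 * int k + 1)) i k m n) (d m n))"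
      unfolding d_def K_def by (rule F_poly_eq_sum) (simp_all add: M)
    hence "monom (q ^ (((2 * k + 2) choose 2) + i)) (2 * k + 1)
        * dilate (q ^ (2 * k + 1)) (F_poly q (N - (2 * int k + 1)) i k) =
        (\<Sum>m<Suc M. \<Sum>n<M. monom (v m (Suc n)) (d m (Suc n)))"
      by (simp only: dilate_sum dilate_monom sum_distrib_left mult_monom)
        (simp add: v_def d_def K_def mult.assoc add_ac del: sum.lessThan_Suc)
    thus ?thesis by (simp add: sum.lessThan_Suc_shift[of _ M] v_def del: sum.lessThan_Suc)
  qed
  have "F_coeff q N i k m n = q ^ d m n * F_coeff q (N - 1) i k m n + u m n - v m n" for m n
    unfolding u_def v_def d_def K_def by (rule F_coeff_recurrence[OF assms])
  hence "monom (F_coeff q N i k m n) (d m n) =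
      monom (q ^ d m n * F_coeff q (N - 1) i k m n) (d m n)
      + monom (u m n) (d m n) - monom (v m n) (d m n)" for m n
    by (simp add: add_monom diff_monom)
  thus ?thesis
    unfolding P1 P2 P3 P0
    by (simp add: sum.distrib sum_subtractf del: sum.lessThan_Suc)
qed

end
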